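(* For every integer $k\ge 1$, $$|\mathrm{RedVHC}_k(\mathrm{Av}_{3k}(312))| = 2\,\frac{(3k)!}{k!\,(k+1)!\,(k+2)!}.$$
   Context: $S_n$ is the set of permutations $\pi=\pi_1\cdots\pi_n$ of $\{1,\dots,n\}$. $\pi$ is $312$-avoiding if there are no indices $a<b<c$ with $\pi_b<\pi_c<\pi_a$; $\mathrm{Av}_n(312)\subseteq S_n$ is the set of $312$-avoiding permutations of length $n$. The plot of $\pi$ is the set of points $(i,\pi_i)$, $1\le i\le n$. If $\pi_i>\pi_{i+1}$, then $i$ is a descent, $(i,\pi_i)$ is a descent top and $(i+1,\pi_{i+1})$ is a descent bottom. A hook on $\pi$ from $(i,\pi_i)$ to $(j,\pi_j)$, where $i<j$ and $\pi_i<\pi_j$, consists of the vertical segment from $(i,\pi_i)$ up to $(i,\pi_j)$ followed by the horizontal segment from $(i,\pi_j)$ to $(j,\pi_j)$. The point $(i,\pi_i)$ is its southwest (SW) endpoint and $(j,\pi_j)$ its northeast (NE) endpoint. A valid hook configuration on $\pi$ is a set of hooks on $\pi$ such that: (i) the set of SW endpoints of the hooks is exactly the set of descent tops of $\pi$; (ii) no point of the plot lies directly above a hook (for a hook from $(i,\pi_i)$ to $(j,\pi_j)$ there is no $l$ with $i<l<j$ and $\pi_l>\pi_j$); (iii) distinct hooks do not intersect, except at endpoints (the NE endpoint of one hook may be the SW endpoint of another; two hooks sharing the same NE endpoint, or the same SW endpoint, overlap in a segment and are not allowed). It is reduced if every point of the plot is a hook endpoint or a descent bottom (or both). For a set $S$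 of permutations, $\mathrm{RedVHC}_k(S)$ is the set of all reduced valid hook configurations with exactly $k$ hooks on permutations in $S$ (a configuration includes the data of its underlying permutation). *)

theory Defs
  imports Complex_Main "HOL-Combinatorics.Multiset_Permutations"
begin

text \<open>A permutation of length \<open>n\<close> is given by its one-line notation, a list in
  \<open>permutations_of_set {1..n}\<close>. Positions are counted from 1, hence \<open>entry\<close>; position 0 is
  meaningless and is excluded wherever positions are quantified.\<close>

definition entry :: "nat list \<Rightarrow> nat \<Rightarrow> nat" where
  "entry \<pi> i = \<pi> ! (i - 1)"

definition avoids_312 :: "nat list \<Rightarrow> bool" where
  "avoids_312 \<pi> \<longleftrightarrow> \<not> (\<exists>a b c. 1 \<le> a \<and> a < b \<and> b < c \<and> c \<le> length \<pi> \<and>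
     entry \<pi> b < entry \<pi> c \<and> entry \<pi> c < entry \<pi> a)"

definition Av_312 :: "nat \<Rightarrow> nat list set" where
  "Av_312 n = {\<pi> \<in> permutations_of_set {1..n}. avoids_312 \<pi>}"

definition point :: "nat list \<Rightarrow> nat \<Rightarrow> real \<times> real" where
  "point \<pi> i = (real i, real (entry \<pi> i))"

definition plot :: "nat list \<Rightarrow> (real \<times> real) set" where
  "plot \<pi> = point \<pi> ` {1..length \<pi>}"

definition descents :: "nat list \<Rightarrow> nat set" where
  "descents \<pi> = {i. 1 \<le> i \<and> i < length \<pi> \<and> entry \<pi> i > entry \<pi> (i + 1)}"

definition descent_tops :: "nat list \<Rightarrow> (real \<times> real) set" where
  "descent_tops \<pi> = point \<pi> ` descents \<pi>"

definition descent_bottoms :: "nat list \<Rightarrow> (real \<times> real) set" where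
  "descent_bottoms \<pi> = (\<lambda>i. point \<pi> (i + 1)) ` descents \<pi>"

text \<open>A hook is stored as the pair \<open>(i, j)\<close> of the positions of its endpoints; its segments,
  as subsets of the plane, are recovered by \<open>hook_curve\<close>.\<close>

definition hooks :: "nat list \<Rightarrow> (nat \<times> nat) set" where
  "hooks \<pi> = {(i, j). 1 \<le> i \<and> i < j \<and> j \<le> length \<pi> \<and> entry \<pi> i < entry \<pi> j}"

definition SW :: "nat list \<Rightarrow> nat \<times> nat \<Rightarrow> real \<times> real" where
  "SW \<pi> h = point \<pi> (fst h)"

definition NE :: "nat list \<Rightarrow> nat \<times> nat \<Rightarrow> real \<times> real" where
  "NE \<pi> h = point \<pi> (snd h)"

fun hook_curve :: "nat list \<Rightarrow> nat \<times> nat \<Rightarrow> (real \<times> real) set" where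
  "hook_curve \<pi> (i, j) =
     {real i} \<times> {real (entry \<pi> i)..real (entry \<pi> j)} \<union>
     {real i..real j} \<times> {real (entry \<pi> j)}"

definition valid_hook_configuration :: "nat list \<Rightarrow> (nat \<times> nat) set \<Rightarrow> bool" where
  "valid_hook_configuration \<pi> H \<longleftrightarrow>
     H \<subseteq> hooks \<pi> \<and>
     SW \<pi> ` H = descent_tops \<pi> \<and>
     (\<forall>(i, j)\<in>H. \<not> (\<exists>l. i < l \<and> l < j \<and> entry \<pi> l > entry \<pi> j)) \<and>
     (\<forall>h\<in>H. \<forall>h'\<in>H. h \<noteq> h' \<longrightarrow>
        hook_curve \<pi> h \<inter> hook_curve \<pi> h' \<subseteq> {SW \<pi> h, NE \<pi> h} \<inter> {SW \<pi> h', NE \<pi> h'})"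

definition reduced :: "nat list \<Rightarrow> (nat \<times> nat) set \<Rightarrow> bool" where
  "reduced \<pi> H \<longleftrightarrow> plot \<pi> \<subseteq> SW \<pi> ` H \<union> NE \<pi> ` H \<union> descent_bottoms \<pi>"

definition RedVHC :: "nat \<Rightarrow> nat list set \<Rightarrow> (nat list \<times> (nat \<times> nat) set) set" where
  "RedVHC k S = {(\<pi>, H). \<pi> \<in> S \<and> valid_hook_configuration \<pi> H \<and> reduced \<pi> H \<and> card H = k}"

end

theory Submission
  imports Defs
begin

text \<open>
  A configuration with \<open>k\<close> hooks has \<open>k\<close> descent tops, \<open>k\<close> descent bottoms and \<open>k\<close> northeast
  endpoints, so on \<open>3k\<close> points being reduced means that each point has exactly one of these
  three roles. In a \<open>312\<close>-avoiding permutation every point that is not a descent bottom is a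
  left-to-right maximum, and therefore the geometric conditions on the hooks reduce to their
  being a noncrossing matching of the descent tops with the northeast endpoints. Such a matching
  is unique, and it exists iff in every prefix there are at least as many descent tops as
  northeast endpoints.

  Reading the roles by increasing value yields a word. Generating the permutation with a stack
  recovers it from the word, and the stack never underflows iff every prefix contains at least as
  many bottoms as tops. The configurations thus correspond to the three-letter ballot words with
  \<open>k\<close> letters of each kind, which the hook length formula counts.
\<close>

subsection \<open>Noncrossing matchings\<close>

definition noncrossing_matching :: "nat set \<Rightarrow> nat set \<Rightarrow> (nat \<times> nat) set \<Rightarrow> bool" where
  "noncrossing_matching A B M \<longleftrightarrow>
     fst ` M = A \<and> snd ` M = B \<and> inj_on fst M \<and> inj_on snd M \<and>
     (\<forall>(a, b)\<in>M. a < b) \<and>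
     (\<forall>(a, b)\<in>M. \<forall>(a', b')\<in>M. \<not> (a < a' \<and> a' < b \<and> b < b'))"

text \<open>The prefix condition is tested only at elements of \<open>B\<close>, where the left
  count jumps; for finite sets \<open>ballot_pairD\<close> extends it to every threshold.\<close>

definition ballot_pair :: "nat set \<Rightarrow> nat set \<Rightarrow> bool" where
  "ballot_pair A B \<longleftrightarrow>
     card A = card B \<and> (\<forall>b\<in>B. card {b'\<in>B. b' \<le> b} \<le> card {a\<in>A. a \<le> b})"

text \<open>Sending each element of \<open>B\<close> up to \<open>b\<close> back to its partner is
  injective and lands in the elements of \<open>A\<close> up to \<open>b\<close>.\<close>

lemma noncrossing_matching_imp_ballot_pair:
  assumes M: "noncrossing_matching A B M" and "finite A"
  shows "ballot_pair A B"
proof -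
  have fst: "fst ` M = A" "inj_on fst M" and snd: "snd ` M = B" "inj_on snd M"
    and less: "\<And>a b. (a, b) \<in> M \<Longrightarrow> a < b"
    using M unfolding noncrossing_matching_def by auto
  have "finite M"
    using fst \<open>finite A\<close> finite_image_iff by blast
  have "card {b'\<in>B. b' \<le> b} \<le> card {a\<in>A. a \<le> b}" for b
  proof -
    let ?M = "{p\<in>M. snd p \<le> b}"
    have "{b'\<in>B. b' \<le> b} = snd ` ?M"
      using snd(1) by auto
    then have "card {b'\<in>B. b' \<le> b} \<le> card ?M"
      using \<open>finite M\<close> by (simp add: card_image_le)
    also have "\<dots> = card (fst ` ?M)"
      using fst(2) by (metis (no_types, lifting) card_image inj_on_subset mem_Collect_eq subsetI)
    also have "\<dots> \<le> card {a\<in>A. a \<le> b}"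
    proof (rule card_mono)
      show "fst ` ?M \<subseteq> {a\<in>A. a \<le> b}"
        using fst(1) less by (force intro: order.trans[OF less_imp_le])
    qed (use \<open>finite A\<close> in auto)
    finally show ?thesis .
  qed
  moreover have "card A = card B"
    using fst snd card_image by metis
  ultimately show ?thesis
    unfolding ballot_pair_def by blast
qed

text \<open>The count at \<open>b = Min B\<close> forces an element of \<open>A\<close> at or below
  \<open>b\<close>. Removing the pair lowers both counts by one at every remaining element of
  \<open>B\<close>, so the ballot condition survives.\<close>

lemma ballot_pair_innermost:
  assumes "ballot_pair A B" and fin: "finite A" "finite B" and "B \<noteq> {}"
  obtains a b where "a \<in> A" "b \<in> B" "a \<le> b" "\<forall>x\<in>B. b \<le> x"
    "\<forall>x\<in>A. x \<le> b \<longrightarrow> x \<le> a" "ballot_pair (A - {a}) (B - {b})"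
proof -
  define b where "b = Min B"
  define a where "a = Max {a\<in>A. a \<le> b}"
  have b: "b \<in> B" and bmin: "\<And>x. x \<in> B \<Longrightarrow> b \<le> x"
    using fin \<open>B \<noteq> {}\<close> unfolding b_def by auto
  have count: "card {b'\<in>B. b' \<le> x} \<le> card {a\<in>A. a \<le> x}" if "x \<in> B" for x
    using assms(1) that unfolding ballot_pair_def by blast
  have "{b'\<in>B. b' \<le> b} = {b}"
    using b bmin by (auto intro: antisym)
  then have "card {a\<in>A. a \<le> b} > 0"
    using count[OF b] by simp
  then have "{a\<in>A. a \<le> b} \<noteq> {}"
    by (metis card.empty less_irrefl)
  then have "a \<in> {a\<in>A. a \<le> b}"
    unfolding a_def by (intro Max_in) (use fin in auto)
  then have a: "a \<in> A" "a \<le> b"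
    by auto
  have amax: "\<And>x. x \<in> A \<Longrightarrow> x \<le> b \<Longrightarrow> x \<le> a"
    unfolding a_def using fin by (auto intro: Max_ge)
  have "card {b'\<in>B - {b}. b' \<le> x} \<le> card {a'\<in>A - {a}. a' \<le> x}" if "x \<in> B - {b}" for x
  proof -
    have "{b'\<in>B - {b}. b' \<le> x} = {b'\<in>B. b' \<le> x} - {b}"
      "{a'\<in>A - {a}. a' \<le> x} = {a'\<in>A. a' \<le> x} - {a}"
      by auto
    moreover have "b \<in> {b'\<in>B. b' \<le> x}" "a \<in> {a'\<in>A. a' \<le> x}"
      using that a b bmin by (auto intro: order.trans)
    ultimately show ?thesis
      using count[of x] that by simp
  qed
  moreover have "card (A - {a}) = card (B - {b})"
    using a b assms(1) by (simp add: ballot_pair_def)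
  ultimately have "ballot_pair (A - {a}) (B - {b})"
    unfolding ballot_pair_def by blast
  then show thesis
    using that a b bmin amax by blast
qed

text \<open>The least element \<open>b\<close> of \<open>B\<close> must be matched with the largest \<open>a \<in> A\<close> below it:
  otherwise the arcs at \<open>a\<close> and \<open>b\<close> cross. Remove both and iterate.\<close>

lemma ex1_noncrossing_matching:
  assumes "ballot_pair A B" "finite A" "finite B" "A \<inter> B = {}"
  shows "\<exists>!M. noncrossing_matching A B M"
  using assms
proof (induction "card B" arbitrary: A B)
  case 0
  then have "A = {}" "B = {}"
    by (auto simp: ballot_pair_def)
  then show ?case
    by (intro ex1I[of _ "{}"]) (auto simp: noncrossing_matching_def)
next
  case (Suc n)
  then have "B \<noteq> {}"
    by auto
  obtain a b where a: "a \<in> A" and b: "b \<in> B" and "a \<le> b" and min_max: "\<forall>x\<in>B. b \<le> x"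
    "\<forall>x\<in>A. x \<le> b \<longrightarrow> x \<le> a" and bp: "ballot_pair (A - {a}) (B - {b})"
    by (rule ballot_pair_innermost[OF Suc.prems(1-3) \<open>B \<noteq> {}\<close>])
  then have bmin: "\<And>x. x \<in> B \<Longrightarrow> b \<le> x" and amax: "\<And>x. x \<in> A \<Longrightarrow> x \<le> b \<Longrightarrow> x \<le> a"
    by auto
  have "a < b"
    using a b \<open>a \<le> b\<close> Suc.prems(4) by (metis IntI empty_iff le_neq_implies_less)
  have "\<exists>!M. noncrossing_matching (A - {a}) (B - {b}) M"
  proof (rule Suc.hyps(1))
    show "n = card (B - {b})"
      using Suc.hyps(2) b by simp
    show "(A - {a}) \<inter> (B - {b}) = {}"
      using Suc.prems(4) by blast
  qed (use bp Suc.prems(2,3) in simp_all)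
  then obtain M where M: "noncrossing_matching (A - {a}) (B - {b}) M"
    and uniq: "\<And>M'. noncrossing_matching (A - {a}) (B - {b}) M' \<Longrightarrow> M' = M"
    by blast
  show ?case
  proof (rule ex1I[of _ "insert (a, b) M"])
    have im: "fst ` M = A - {a}" "snd ` M = B - {b}" and inj: "inj_on fst M" "inj_on snd M"
      and less: "\<forall>(x, y)\<in>M. x < y"
      and nc: "\<forall>(x, y)\<in>M. \<forall>(x', y')\<in>M. \<not> (x < x' \<and> x' < y \<and> y < y')"
      using M unfolding noncrossing_matching_def by simp_all
    \<comment> \<open>No element of \<open>A\<close> lies strictly between \<open>a\<close> and
      \<open>b\<close>, and \<open>B\<close> starts at \<open>b\<close>, so the arc
      \<open>(a, b)\<close> crosses no arc of \<open>M\<close>.\<close>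
    have new: "\<not> (a < x \<and> x < b) \<and> \<not> y < b" if "(x, y) \<in> M" for x y
    proof -
      have "x \<in> A" "y \<in> B"
        using im imageI[OF that, of fst] imageI[OF that, of snd] by auto
      then show ?thesis
        using amax[of x] bmin[of y] by auto
    qed
    have "fst ` insert (a, b) M = A" "snd ` insert (a, b) M = B"
      using im a b by auto
    moreover have "inj_on fst (insert (a, b) M)" "inj_on snd (insert (a, b) M)"
      using im inj by auto
    moreover have "\<forall>(x, y)\<in>insert (a, b) M. x < y"
      using less \<open>a < b\<close> by simp
    moreover have "\<forall>(x, y)\<in>insert (a, b) M. \<forall>(x', y')\<in>insert (a, b) M.
        \<not> (x < x' \<and> x' < y \<and> y < y')"
      using nc new by fastforce
    ultimately show "noncrossing_matching A B (insert (a, b) M)"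
      by (simp only: noncrossing_matching_def simp_thms)
  next
    fix M'
    assume M': "noncrossing_matching A B M'"
    then have im: "fst ` M' = A" "snd ` M' = B" and inj: "inj_on fst M'" "inj_on snd M'"
      and less: "\<forall>(x, y)\<in>M'. x < y"
      and nc: "\<forall>(x, y)\<in>M'. \<forall>(x', y')\<in>M'. \<not> (x < x' \<and> x' < y \<and> y < y')"
      unfolding noncrossing_matching_def by simp_all
    obtain a' where a': "(a', b) \<in> M'"
      using im(2) b by force
    obtain b' where b': "(a, b') \<in> M'"
      using im(1) a by force
    have "a' \<in> A" "b' \<in> B" "a' < b"
      using im imageI[OF a', of fst] imageI[OF b', of snd] bspec[OF less a'] by auto
    then have "a' \<le> a" "b \<le> b'"
      using amax[of a'] bmin[of b'] by auto
    have "(a, b) \<in> M'"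
    proof (rule ccontr)
      assume "(a, b) \<notin> M'"
      then have "a' < a" "b < b'"
        using \<open>a' \<le> a\<close> \<open>b \<le> b'\<close> a' b' by (metis le_neq_implies_less)+
      then show False
        using bspec[OF bspec[OF nc a', unfolded prod.case] b'] \<open>a < b\<close> by simp
    qed
    moreover have "noncrossing_matching (A - {a}) (B - {b}) (M' - {(a, b)})"
      unfolding noncrossing_matching_def
    proof (intro conjI)
      show "fst ` (M' - {(a, b)}) = A - {a}" "snd ` (M' - {(a, b)}) = B - {b}"
        using inj_on_image_set_diff[OF inj(1), of M' "{(a, b)}"]
          inj_on_image_set_diff[OF inj(2), of M' "{(a, b)}"] \<open>(a, b) \<in> M'\<close> im by auto
      show "inj_on fst (M' - {(a, b)})" "inj_on snd (M' - {(a, b)})"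
        using inj by (auto intro: inj_on_diff)
    qed (use less nc in auto)
    ultimately show "M' = insert (a, b) M"
      using uniq by blast
  qed
qed

text \<open>Only relative order enters the condition. This later moves it from positions to
  values.\<close>

lemma ballot_pair_image:
  assumes "strict_mono_on (A \<union> B) (e :: nat \<Rightarrow> nat)"
  shows "ballot_pair (e ` A) (e ` B) \<longleftrightarrow> ballot_pair A B"
proof -
  have inj: "inj_on e (A \<union> B)"
    using assms by (rule strict_mono_on_imp_inj_on)
  have le: "e x \<le> e y \<longleftrightarrow> x \<le> y" if "x \<in> A \<union> B" "y \<in> A \<union> B" for x y
    using assms that by (simp add: strict_mono_on_less_eq)
  have "card {x\<in>e ` C. x \<le> e b} = card {x\<in>C. x \<le> b}" if "b \<in> B" "C = A \<or> C = B" for b C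
  proof -
    have "{x\<in>e ` C. x \<le> e b} = e ` {x\<in>C. x \<le> b}"
      using le that by auto
    moreover have "inj_on e {x\<in>C. x \<le> b}"
      using inj by (rule inj_on_subset) (use that in auto)
    ultimately show ?thesis
      by (simp add: card_image)
  qed
  moreover have "card (e ` A) = card A" "card (e ` B) = card B"
    using inj by (auto intro!: card_image intro: inj_on_subset)
  ultimately show ?thesis
    unfolding ballot_pair_def by simp
qed

lemma ballot_pairD:
  assumes "ballot_pair A B" "finite A" "finite B"
  shows "card {b\<in>B. b \<le> v} \<le> card {a\<in>A. a \<le> v}"
proof (cases "{b\<in>B. b \<le> v} = {}")
  case False
  define b where "b = Max {b\<in>B. b \<le> v}"
  have "b \<in> {b\<in>B. b \<le> v}"
    unfolding b_def using False assms(3) by (intro Max_in) auto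
  have "{b\<in>B. b \<le> v} = {x\<in>B. x \<le> b}"
    using \<open>b \<in> _\<close> assms(3) unfolding b_def by (auto intro: Max_ge)
  then have "card {b\<in>B. b \<le> v} \<le> card {a\<in>A. a \<le> b}"
    using assms(1) \<open>b \<in> _\<close> unfolding ballot_pair_def by simp
  also have "\<dots> \<le> card {a\<in>A. a \<le> v}"
    using \<open>b \<in> _\<close> assms(2) by (intro card_mono) auto
  finally show ?thesis .
qed (simp only: card.empty)

subsection \<open>Ballot words on three letters\<close>

datatype letter = Bottom | Top | NEnd

definition balanced :: "letter list \<Rightarrow> bool" where
  "balanced w \<longleftrightarrow> count_list w Top \<le> count_list w Bottom \<and> count_list w NEnd \<le> count_list w Top"

definition ballot :: "letter list \<Rightarrow> bool" where
  "ballot w \<longleftrightarrow> (\<forall>n. balanced (take n w))"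

text \<open>These are the lattice words of content \<open>(a, b, c)\<close>. With letters naming
  rows, they encode the standard Young tableaux with rows of lengths \<open>a\<close>,
  \<open>b\<close>, \<open>c\<close>.\<close>

definition ballot_words :: "nat \<Rightarrow> nat \<Rightarrow> nat \<Rightarrow> letter list set" where
  "ballot_words a b c = {w. ballot w \<and> count_list w Bottom = a \<and> count_list w Top = b \<and>
                            count_list w NEnd = c}"

lemma length_eq_sum_count_letters:
  "length w = count_list w Bottom + count_list w Top + count_list w NEnd"
proof (induction w)
  case (Cons x w)
  then show ?case by (cases x) auto
qed simp

lemma ballot_snoc: "ballot (w @ [x]) \<longleftrightarrow> ballot w \<and> balanced (w @ [x])"
proof
  assume L: "ballot (w @ [x])"
  have "balanced (take n w)" for n
    using L[unfolded ballot_def, rule_format, of "min n (length w)"]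
    by (cases "n \<le> length w") simp_all
  then show "ballot w \<and> balanced (w @ [x])"
    using L[unfolded ballot_def, rule_format, of "Suc (length w)"] by (simp add: ballot_def)
next
  assume R: "ballot w \<and> balanced (w @ [x])"
  have "balanced (take n (w @ [x]))" for n
    using R by (cases "n \<le> length w") (simp_all add: ballot_def)
  then show "ballot (w @ [x])"
    by (simp add: ballot_def)
qed

lemma ballot_imp_balanced: "ballot w \<Longrightarrow> balanced w"
  unfolding ballot_def by (metis take_all order.refl)

lemma finite_ballot_words: "finite (ballot_words a b c)"
proof (rule finite_subset)
  show "ballot_words a b c \<subseteq> {w. set w \<subseteq> {Bottom, Top, NEnd} \<and> length w = a + b + c}"
    by (auto simp: ballot_words_def length_eq_sum_count_letters) (metis letter.exhaust)
qed (simp add: finite_lists_length_eq)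

lemma ballot_words_empty: "\<not> (c \<le> b \<and> b \<le> a) \<Longrightarrow> ballot_words a b c = {}"
  using ballot_imp_balanced by (force simp: ballot_words_def balanced_def)

text \<open>Deleting the last letter removes a corner of the tableau. The guards are there because
  \<open>b - 1\<close> and \<open>c - 1\<close> truncate at 0.\<close>

lemma ballot_words_last:
  assumes "c \<le> b" "b \<le> a" "a > 0"
  shows "ballot_words a b c =
    (\<lambda>w. w @ [Bottom]) ` ballot_words (a - 1) b c \<union>
    (if b > 0 then (\<lambda>w. w @ [Top]) ` ballot_words a (b - 1) c else {}) \<union>
    (if c > 0 then (\<lambda>w. w @ [NEnd]) ` ballot_words a b (c - 1) else {})"
    (is "?L = ?R")
proof (intro equalityI subsetI)
  fix w assume w: "w \<in> ?L"
  then have "w \<noteq> []"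
    using assms by (auto simp: ballot_words_def)
  then obtain u x where "w = u @ [x]"
    by (metis rev_exhaust)
  then show "w \<in> ?R"
    using w by (cases x) (auto simp: ballot_words_def ballot_snoc balanced_def)
next
  fix w assume "w \<in> ?R"
  then show "w \<in> ?L"
    using assms by (auto simp: ballot_words_def ballot_snoc balanced_def split: if_splits)
qed

lemma card_ballot_words_last:
  assumes "c \<le> b" "b \<le> a" "a > 0"
  shows "card (ballot_words a b c) = card (ballot_words (a - 1) b c) +
    (if b > 0 then card (ballot_words a (b - 1) c) else 0) +
    (if c > 0 then card (ballot_words a b (c - 1)) else 0)"
proof -
  have inj: "inj_on (\<lambda>w. w @ [x]) W" for x :: letter and W
    by (rule inj_onI) simp
  have disj: "(\<lambda>w. w @ [x]) ` W \<inter> (\<lambda>w. w @ [y]) ` W' = {}" if "x \<noteq> y" for x y :: letter and W W'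
    using that by auto
  show ?thesis
    unfolding ballot_words_last[OF assms]
    by (simp add: card_Un_disjoint finite_ballot_words card_image[OF inj] Int_Un_distrib2 disj)
qed

text \<open>This is the hook length formula for a diagram with three rows, with denominators cleared.
  The hypotheses admit the boundary cases \<open>c = b + 1\<close> and \<open>b = a + 1\<close>, where both sides
  vanish, so that the recursion on the last letter needs no case distinction there.\<close>

lemma card_ballot_words:
  assumes "c \<le> b + 1" "b \<le> a + 1"
  shows "real (card (ballot_words a b c)) * (fact (a + 2) * fact (b + 1) * fact c) =
    fact (a + b + c) * ((real a - b + 1) * (real a - c + 2) * (real b - c + 1))"
  using assms
proof (induction "a + b + c" arbitrary: a b c rule: less_induct)
  case less
  show ?case
  proof (cases "c \<le> b \<and> b \<le> a")
    case False
    then have "real a - b + 1 = 0 \<or> real b - c + 1 = 0"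
      using less.prems by linarith
    then show ?thesis
      using ballot_words_empty[OF False] by auto
  next
    case True
    show ?thesis
    proof (cases "a = 0")
      case True
      have "ballot_words 0 0 0 = {[]}"
        by (auto simp: ballot_words_def ballot_def balanced_def length_eq_sum_count_letters
            simp flip: length_0_conv)
      then show ?thesis
        using True \<open>c \<le> b \<and> b \<le> a\<close> by (cases c) simp_all
    next
      case False
      then obtain a' where a: "a = Suc a'"
        using not0_implies_Suc by blast
      define n where "n = a' + b + c"
      \<comment> \<open>\<open>F\<close> collects the factorials at \<open>(a, b, c)\<close>. In
        each of the three cases \<open>G\<close> does so at the smaller triple, and \<open>F\<close>
        is \<open>G\<close> times one linear factor.\<close>
      define F where "F = (fact (a + 2) * fact (b + 1) * fact c :: real)"
      have 1: "real (card (ballot_words (a - 1) b c)) * F =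
          fact n * ((real a + 2) * (real a - b) * (real a - c + 1) * (real b - c + 1))"
      proof -
        define G where "G = (fact (a' + 2) * fact (b + 1) * fact c :: real)"
        have IH: "real (card (ballot_words a' b c)) * G =
            fact n * ((real a' - b + 1) * (real a' - c + 2) * (real b - c + 1))"
          unfolding n_def G_def by (rule less.hyps) (use \<open>c \<le> b \<and> b \<le> a\<close> a in auto)
        have "F = (real a + 2) * G"
          by (simp add: F_def G_def a algebra_simps)
        then have "real (card (ballot_words a' b c)) * F =
            (real a + 2) * (real (card (ballot_words a' b c)) * G)"
          by simp
        also have "\<dots> = fact n * ((real a + 2) * (real a - b) * (real a - c + 1) * (real b - c + 1))"
          unfolding IH by (simp add: a algebra_simps)
        finally show ?thesis
          by (simp only: a diff_Suc_1)
      qed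
      have 2: "real (if b > 0 then card (ballot_words a (b - 1) c) else 0) * F =
          fact n * ((real b + 1) * (real a - b + 2) * (real a - c + 2) * (real b - c))"
      proof (cases b)
        case 0
        then show ?thesis using \<open>c \<le> b \<and> b \<le> a\<close> by simp
      next
        case (Suc b')
        define G where "G = (fact (a + 2) * fact (b' + 1) * fact c :: real)"
        have "a + b' + c = n"
          by (simp add: n_def a Suc)
        moreover have "real (card (ballot_words a b' c)) * G =
            fact (a + b' + c) * ((real a - b' + 1) * (real a - c + 2) * (real b' - c + 1))"
          unfolding G_def by (rule less.hyps) (use \<open>c \<le> b \<and> b \<le> a\<close> Suc in auto)
        ultimately have IH: "real (card (ballot_words a b' c)) * G =
            fact n * ((real a - b' + 1) * (real a - c + 2) * (real b' - c + 1))"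
          by simp
        have "F = (real b + 1) * G"
          by (simp add: F_def G_def Suc algebra_simps)
        then have "real (card (ballot_words a b' c)) * F =
            (real b + 1) * (real (card (ballot_words a b' c)) * G)"
          by simp
        also have "\<dots> = fact n * ((real b + 1) * (real a - b + 2) * (real a - c + 2) * (real b - c))"
          unfolding IH by (simp add: Suc algebra_simps)
        finally show ?thesis
          by (simp only: Suc diff_Suc_1 zero_less_Suc if_True)
      qed
      have 3: "real (if c > 0 then card (ballot_words a b (c - 1)) else 0) * F =
          fact n * (real c * (real a - b + 1) * (real a - c + 3) * (real b - c + 2))"
      proof (cases c)
        case (Suc c')
        define G where "G = (fact (a + 2) * fact (b + 1) * fact c' :: real)"
        have "a + b + c' = n"
          by (simp add: n_def a Suc)
        moreover have "real (card (ballot_words a b c')) * G =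
            fact (a + b + c') * ((real a - b + 1) * (real a - c' + 2) * (real b - c' + 1))"
          unfolding G_def by (rule less.hyps) (use \<open>c \<le> b \<and> b \<le> a\<close> Suc in auto)
        ultimately have IH: "real (card (ballot_words a b c')) * G =
            fact n * ((real a - b + 1) * (real a - c' + 2) * (real b - c' + 1))"
          by simp
        have "F = real c * G"
          by (simp add: F_def G_def Suc algebra_simps)
        then have "real (card (ballot_words a b c')) * F =
            real c * (real (card (ballot_words a b c')) * G)"
          by simp
        also have "\<dots> = fact n * (real c * (real a - b + 1) * (real a - c + 3) * (real b - c + 2))"
          unfolding IH by (simp add: Suc algebra_simps)
        finally show ?thesis
          by (simp only: Suc diff_Suc_1 zero_less_Suc if_True)
      qed simp
      have "real (card (ballot_words a b c)) * F =
          fact n * ((real a + 2) * (real a - b) * (real a - c + 1) * (real b - c + 1)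
            + (real b + 1) * (real a - b + 2) * (real a - c + 2) * (real b - c)
            + real c * (real a - b + 1) * (real a - c + 3) * (real b - c + 2))"
        using 1 2 3 card_ballot_words_last[of c b a] \<open>c \<le> b \<and> b \<le> a\<close> False
        by (simp only: of_nat_add distrib_left distrib_right)
      \<comment> \<open>The recursion comes down to this polynomial identity; its factor
        \<open>a + b + c = n + 1\<close> then turns \<open>fact n\<close> into
        \<open>fact (a + b + c)\<close>.\<close>
      also have "\<dots> = fact n * ((real a + b + c) *
          ((real a - b + 1) * (real a - c + 2) * (real b - c + 1)))"
        by (simp add: algebra_simps)
      also have "\<dots> = fact (a + b + c) * ((real a - b + 1) * (real a - c + 2) * (real b - c + 1))"
        by (simp add: n_def a)
      finally show ?thesis
        unfolding F_def .
    qed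
  qed
qed

text \<open>On the diagonal the three linear factors are 1, 2 and 1, whence the leading 2.\<close>

corollary card_ballot_words_diag:
  "real (card (ballot_words k k k)) = 2 * (fact (3 * k) / (fact k * fact (k + 1) * fact (k + 2)))"
proof -
  have "real (card (ballot_words k k k)) * (fact (k + 2) * fact (k + 1) * fact k) = 2 * fact (3 * k)"
    using card_ballot_words[of k k k] by (simp only: numeral_3_eq_3) (simp add: add.assoc)
  then show ?thesis
    by (simp only: eq_divide_eq times_divide_eq_right) (simp add: ac_simps del: fact_Suc)
qed

subsection \<open>The stack machine\<close>

text \<open>The machine receives \<open>m, m + 1, \<dots>\<close> in turn. \<open>Bottom\<close> keeps the incoming value on the
  stack, \<open>NEnd\<close> outputs it at once, and \<open>Top\<close> outputs it followed by the top of the stack.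
  Thus the letters record the roles of the values in the output.\<close>

fun stack_output :: "nat list \<Rightarrow> nat \<Rightarrow> letter list \<Rightarrow> nat list" where
  "stack_output st m [] = []"
| "stack_output st m (Bottom # w) = stack_output (m # st) (Suc m) w"
| "stack_output st m (NEnd # w) = m # stack_output st (Suc m) w"
| "stack_output st m (Top # w) = m # hd st # stack_output (tl st) (Suc m) w"

text \<open>Started with \<open>l\<close> values on the stack, the machine never pops an empty stack
  and finishes with none left. This keeps \<open>hd st\<close> and \<open>tl st\<close> in
  \<open>stack_output\<close> meaningful.\<close>

fun empties :: "nat \<Rightarrow> letter list \<Rightarrow> bool" where
  "empties l [] \<longleftrightarrow> l = 0"
| "empties l (Bottom # w) \<longleftrightarrow> empties (Suc l) w"
| "empties l (NEnd # w) \<longleftrightarrow> empties l w"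
| "empties l (Top # w) \<longleftrightarrow> 0 < l \<and> empties (l - 1) w"

lemma all_nat_0_Suc: "(\<forall>n. P n) \<longleftrightarrow> P 0 \<and> (\<forall>n. P (Suc n))"
  by (metis nat.exhaust)

text \<open>The stack height after \<open>n\<close> letters is \<open>l\<close> plus the number of
  \<open>Bottom\<close> minus the number of \<open>Top\<close>; writing this as a comparison avoids
  truncated subtraction.\<close>

lemma empties_iff:
  "empties l w \<longleftrightarrow> count_list w Top = l + count_list w Bottom \<and>
     (\<forall>n. count_list (take n w) Top \<le> l + count_list (take n w) Bottom)"
proof (induction l w rule: empties.induct)
  case (2 l w)
  then show ?case
    by (subst all_nat_0_Suc) simp
next
  case (3 l w)
  then show ?case
    by (subst all_nat_0_Suc) simp
next
  case (4 l w)
  show ?case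
  proof (cases l)
    case 0
    have "\<not> count_list (take 1 (Top # w)) Top \<le> l + count_list (take 1 (Top # w)) Bottom"
      using 0 by simp
    then show ?thesis
      using 0 by (metis empties.simps(4) less_irrefl)
  next
    case (Suc l')
    then show ?thesis
      by (subst all_nat_0_Suc) (use 4 in simp)
  qed
qed auto

lemma mset_stack_output:
  "empties (length st) w \<Longrightarrow> mset (stack_output st m w) = mset st + mset [m..<m + length w]"
proof (induction st m w rule: stack_output.induct)
  have upt: "[m..<m + length (x # w)] = m # [Suc m..<Suc m + length w]" for m and x :: letter and w
    by (simp add: upt_conv_Cons del: upt_Suc)
  {
    case (2 st m w)
    then show ?case by (simp only: upt) simp
  next
    case (3 st m w)
    then show ?case by (simp only: upt) simp
  next
    case (4 st m w)
    then show ?case by (cases st) (simp_all only: upt, simp_all)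
  }
qed simp

text \<open>A stacked value is released only right after the incoming value of a \<open>Top\<close>,
  so the output opens with an incoming value. This rules out descents between the output of one
  letter and what follows.\<close>

lemma stack_output_hd:
  assumes "empties (length st) w" "stack_output st m w \<noteq> []"
  shows "m \<le> hd (stack_output st m w)"
  using assms
proof (induction st m w rule: stack_output.induct)
  case (2 st m w)
  then have "Suc m \<le> hd (stack_output st m (Bottom # w))"
    by simp
  then show ?case by linarith
qed simp_all

lemma filter_less_filter_less_Suc:
  "filter (\<lambda>x. x < m) (filter (\<lambda>x. x < Suc m) xs) = filter (\<lambda>x. x < m) xs"
  unfolding filter_filter by (rule filter_cong) auto

lemma filter_less_Suc: "m \<notin> set xs \<Longrightarrow> filter (\<lambda>x. x < Suc m) xs = filter (\<lambda>x. x < m) xs"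
  by (rule filter_cong) (auto simp: less_Suc_eq)

text \<open>The stack is last in, first out, so its initial contents leave in stack order. The
  induction works at threshold \<open>Suc m\<close> and then lowers it to \<open>m\<close> by
  filtering again.\<close>

lemma filter_less_stack_output:
  assumes "empties (length st) w" "\<forall>x\<in>set st. x < m"
  shows "filter (\<lambda>x. x < m) (stack_output st m w) = st"
  using assms
proof (induction st m w rule: stack_output.induct)
  case (2 st m w)
  then have "filter (\<lambda>x. x < Suc m) (stack_output (m # st) (Suc m) w) = m # st"
    by (auto intro: less_SucI)
  then show ?case
    using 2 by (subst filter_less_filter_less_Suc[symmetric]) auto
next
  case (3 st m w)
  then have "filter (\<lambda>x. x < Suc m) (stack_output st (Suc m) w) = st"
    by (auto intro: less_SucI)
  then show ?case
    using 3 by simp (subst filter_less_filter_less_Suc[symmetric], auto)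
next
  case (4 st m w)
  then obtain s st' where st: "st = s # st'"
    by (cases st) auto
  have "filter (\<lambda>x. x < Suc m) (stack_output st' (Suc m) w) = st'"
    using 4 st by (auto intro: less_SucI)
  then show ?case
    using 4 st by simp (subst filter_less_filter_less_Suc[symmetric], auto)
qed simp

section \<open>Avoidance of 312 by recursion on the list\<close>

lemma avoids_312_iff_nth:
  "avoids_312 \<pi> \<longleftrightarrow> (\<forall>a b c. a < b \<and> b < c \<and> c < length \<pi> \<longrightarrow> \<not> (\<pi> ! b < \<pi> ! c \<and> \<pi> ! c < \<pi> ! a))"
  (is "_ \<longleftrightarrow> ?R")
proof
  assume L: "avoids_312 \<pi>"
  have "\<not> (\<pi> ! b < \<pi> ! c \<and> \<pi> ! c < \<pi> ! a)" if "a < b" "b < c" "c < length \<pi>" for a b c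
    using L that unfolding avoids_312_def entry_def
    by (metis One_nat_def Suc_leI Suc_less_eq diff_Suc_1 le_SucI less_Suc_eq_le zero_less_Suc)
  then show ?R by blast
next
  assume R: ?R
  have "\<not> (entry \<pi> b < entry \<pi> c \<and> entry \<pi> c < entry \<pi> a)"
    if "1 \<le> a" "a < b" "b < c" "c \<le> length \<pi>" for a b c
  proof -
    have "a - 1 < b - 1 \<and> b - 1 < c - 1 \<and> c - 1 < length \<pi>"
      using that by linarith
    then show ?thesis
      using R unfolding entry_def by blast
  qed
  then show "avoids_312 \<pi>"
    unfolding avoids_312_def by blast
qed

lemma avoids_312_Nil: "avoids_312 []"
  by (simp add: avoids_312_iff_nth)

lemma sorted_wrt_filter_iff:
  "sorted_wrt P (filter Q xs) \<longleftrightarrow> sorted_wrt (\<lambda>a b. Q a \<longrightarrow> Q b \<longrightarrow> P a b) xs"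
  by (induction xs) auto

text \<open>The first entry can act only as the 3 of a pattern, the other two being an increasing
  pair of smaller later entries. Distinctness turns the absence of such pairs into strict
  decrease.\<close>

lemma avoids_312_Cons:
  assumes "distinct xs"
  shows "avoids_312 (x # xs) \<longleftrightarrow> sorted_wrt (>) (filter (\<lambda>y. y < x) xs) \<and> avoids_312 xs"
proof -
  have "avoids_312 (x # xs) \<longleftrightarrow>
      (\<forall>b c. b < c \<and> c < length xs \<longrightarrow> \<not> (xs ! b < xs ! c \<and> xs ! c < x)) \<and> avoids_312 xs"
    (is "?L \<longleftrightarrow> ?R")
  proof
    assume L: ?L
    note L = L[unfolded avoids_312_iff_nth, rule_format]
    show ?R
      unfolding avoids_312_iff_nth
    proof (intro conjI allI impI)
      fix b c assume "b < c \<and> c < length xs"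
      then show "\<not> (xs ! b < xs ! c \<and> xs ! c < x)"
        using L[of 0 "Suc b" "Suc c"] by simp
    next
      fix a b c assume "a < b \<and> b < c \<and> c < length xs"
      then show "\<not> (xs ! b < xs ! c \<and> xs ! c < xs ! a)"
        using L[of "Suc a" "Suc b" "Suc c"] by simp
    qed
  next
    assume R: ?R
    show ?L
      unfolding avoids_312_iff_nth
    proof (intro allI impI)
      fix a b c assume abc: "a < b \<and> b < c \<and> c < length (x # xs)"
      then obtain b' c' where "b = Suc b'" "c = Suc c'"
        by (metis less_imp_Suc_add less_trans)
      then show "\<not> ((x # xs) ! b < (x # xs) ! c \<and> (x # xs) ! c < (x # xs) ! a)"
        using R abc by (cases a) (auto simp: avoids_312_iff_nth)
    qed
  qed
  also have "(\<forall>b c. b < c \<and> c < length xs \<longrightarrow> \<not> (xs ! b < xs ! c \<and> xs ! c < x)) \<longleftrightarrow>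
      (\<forall>b c. b < c \<longrightarrow> c < length xs \<longrightarrow> xs ! b < x \<longrightarrow> xs ! c < x \<longrightarrow> xs ! b > xs ! c)"
  proof -
    have "\<not> (xs ! b < xs ! c \<and> xs ! c < x) \<longleftrightarrow> (xs ! b < x \<longrightarrow> xs ! c < x \<longrightarrow> xs ! b > xs ! c)"
      if "b < c" "c < length xs" for b c
    proof -
      have "xs ! b \<noteq> xs ! c"
        using assms that by (simp add: nth_eq_iff_index_eq)
      then show ?thesis by linarith
    qed
    then show ?thesis by (simp add: imp_conjL cong: imp_cong)
  qed
  also have "\<dots> \<longleftrightarrow> sorted_wrt (>) (filter (\<lambda>y. y < x) xs)"
    by (simp only: sorted_wrt_filter_iff) (simp add: sorted_wrt_iff_nth_less)
  finally show ?thesis .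
qed

lemma distinct_stack_output:
  assumes "empties (length st) w" "sorted_wrt (>) st" "\<forall>x\<in>set st. x < m"
  shows "distinct (stack_output st m w)"
proof -
  have "distinct (st @ [m..<m + length w])"
    using assms strict_sorted_iff[of "rev st"] by (auto simp: sorted_wrt_rev)
  then show ?thesis
    using mset_stack_output[OF assms(1), of m] by (metis mset_append mset_eq_imp_distinct_iff)
qed

text \<open>When a value is output, the smaller entries still to come are exactly those waiting on
  the stack, in decreasing order, so it is never the 3 of a pattern.\<close>

lemma avoids_312_stack_output:
  assumes "empties (length st) w" "sorted_wrt (>) st" "\<forall>x\<in>set st. x < m"
  shows "avoids_312 (stack_output st m w)"
  using assms
proof (induction st m w rule: stack_output.induct)
  case (2 st m w)
  then show ?case by (auto intro: less_SucI)
next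
  case (3 st m w)
  then have "filter (\<lambda>x. x < m) (stack_output st m (NEnd # w)) = st"
    by (intro filter_less_stack_output) auto
  moreover have "distinct (stack_output st (Suc m) w)"
    using 3 by (intro distinct_stack_output) (auto intro: less_SucI)
  ultimately show ?case
    using 3 by (auto simp: avoids_312_Cons intro: less_SucI)
next
  case (4 st m w)
  then obtain s st' where st: "st = s # st'"
    by (cases st) auto
  have flt: "filter (\<lambda>x. x < Suc m) (stack_output st' (Suc m) w) = st'"
    using 4 st by (intro filter_less_stack_output) (auto intro: less_SucI)
  have dist: "distinct (stack_output st m (Top # w))"
    using 4 by (intro distinct_stack_output) auto
  have flt_m: "filter (\<lambda>x. x < m) (stack_output st m (Top # w)) = st"
    using 4 by (intro filter_less_stack_output)
  \<comment> \<open>Since \<open>s < m\<close>, truncating at \<open>Suc m\<close> first loses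
    nothing and reduces the entries below \<open>s\<close> to the remaining stack
    \<open>st'\<close>.\<close>
  have "filter (\<lambda>x. x < s) (stack_output st' (Suc m) w) =
      filter (\<lambda>x. x < s) (filter (\<lambda>x. x < Suc m) (stack_output st' (Suc m) w))"
    using 4 st by (auto intro!: filter_cong)
  then have "filter (\<lambda>x. x < s) (stack_output st' (Suc m) w) = filter (\<lambda>x. x < s) st'"
    using flt by simp
  moreover have "avoids_312 (stack_output st' (Suc m) w)"
    using 4 st by (auto intro: less_SucI)
  moreover have "sorted_wrt (>) (filter (\<lambda>x. x < s) st')"
    using 4 st by (simp add: sorted_wrt_filter)
  ultimately have "avoids_312 (s # stack_output st' (Suc m) w)"
    using dist st by (simp add: avoids_312_Cons)
  moreover have "filter (\<lambda>x. x < m) (s # stack_output st' (Suc m) w) = st"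
    using flt_m st by simp
  ultimately show ?case
    using 4 st dist by (simp add: avoids_312_Cons del: filter.simps)
qed (simp add: avoids_312_Nil)

section \<open>Descents and letters by value\<close>

fun descent_pairs :: "nat list \<Rightarrow> (nat \<times> nat) set" where
  "descent_pairs (x # y # xs) = (if y < x then {(x, y)} else {}) \<union> descent_pairs (y # xs)"
| "descent_pairs xs = {}"

lemma descent_pairs_Cons:
  "descent_pairs (x # xs) = (if xs \<noteq> [] \<and> hd xs < x then {(x, hd xs)} else {}) \<union> descent_pairs xs"
  by (cases xs) auto

definition values_with :: "letter \<Rightarrow> nat \<Rightarrow> letter list \<Rightarrow> nat set" where
  "values_with c m w = {v. m \<le> v \<and> v < m + length w \<and> w ! (v - m) = c}"

lemma values_with_Nil: "values_with c m [] = {}"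
  by (auto simp: values_with_def)

lemma values_with_Cons:
  "values_with c m (x # w) = (if x = c then {m} else {}) \<union> values_with c (Suc m) w"
proof -
  have "v \<in> values_with c m (x # w) \<longleftrightarrow> v \<in> (if x = c then {m} else {}) \<union> values_with c (Suc m) w" for v
    by (cases "v \<le> m") (auto simp: values_with_def nth_Cons' )
  then show ?thesis by blast
qed

text \<open>Each \<open>Top\<close> outputs a descent from \<open>m\<close> to the popped value. No
  other descents arise, since by \<open>stack_output_hd\<close> the output of the later letters
  starts with at least \<open>Suc m\<close>. Every stacked value is eventually popped and so becomes
  a bottom.\<close>

lemma descent_pairs_stack_output:
  assumes "empties (length st) w" "\<forall>x\<in>set st. x < m"
  shows "fst ` descent_pairs (stack_output st m w) = values_with Top m w \<and>
    snd ` descent_pairs (stack_output st m w) = set st \<union> values_with Bottom m w"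
  using assms
proof (induction st m w rule: stack_output.induct)
  case (2 st m w)
  have "\<forall>x\<in>set (m # st). x < Suc m"
    using 2 by auto
  then show ?case
    using 2 by (simp add: values_with_Cons)
next
  case (3 st m w)
  have "\<forall>x\<in>set st. x < Suc m"
    using 3 by auto
  then show ?case
    using 3 stack_output_hd[of st w "Suc m"]
    by (cases "stack_output st (Suc m) w = []") (simp_all add: descent_pairs_Cons values_with_Cons)
next
  case (4 st m w)
  then obtain s st' where st: "st = s # st'"
    by (cases st) auto
  have "\<forall>x\<in>set st'. x < Suc m" "s < m"
    using 4(3) st by auto
  moreover from this have "fst ` descent_pairs (stack_output st' (Suc m) w) = values_with Top (Suc m) w"
    "snd ` descent_pairs (stack_output st' (Suc m) w) = set st' \<union> values_with Bottom (Suc m) w"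
    using 4(1,2) st by simp_all
  ultimately show ?case
    using 4(2) stack_output_hd[of st' w "Suc m"]
    by (cases "stack_output st' (Suc m) w = []")
       (simp_all add: descent_pairs_Cons values_with_Cons st insert_commute)
qed (simp add: values_with_Nil)

text \<open>The first element \<open>x\<close> of the list determines the next letter: if \<open>x \<noteq> m\<close>, then \<open>m\<close> has
  to wait on the stack, and avoidance of \<open>312\<close> (with \<open>x\<close> as the 3) forces it to leave before
  the rest of the stack.\<close>

lemma stack_output_surj:
  assumes "distinct xs" "avoids_312 xs" "fst ` descent_pairs xs \<inter> snd ` descent_pairs xs = {}"
    and "m \<le> M" "set xs = set st \<union> {m..<M}" "filter (\<lambda>x. x < m) xs = st"
    and "sorted_wrt (>) st" "\<forall>x\<in>set st. x < m" "xs \<noteq> [] \<Longrightarrow> m \<le> hd xs"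
  shows "\<exists>w. empties (length st) w \<and> length w = M - m \<and> stack_output st m w = xs"
  using assms
proof (induction "M - m" arbitrary: m xs st)
  case 0
  then have "m = M" "set xs = set st" by auto
  \<comment> \<open>Every entry is now on the stack and hence below \<open>m\<close>, whereas a
    first entry would be at least \<open>m\<close>.\<close>
  then have "xs = []"
    using 0 by (metis hd_in_set leD)
  then show ?case
    using 0 \<open>m = M\<close> by (intro exI[of _ "[]"]) auto
next
  case (Suc d)
  then have "m < M" by simp
  then have range: "{m..<M} = insert m {Suc m..<M}"
    by auto
  then obtain x ys where xs: "xs = x # ys"
    using Suc.prems(5) by (cases xs) auto
  have "m \<le> x"
    using Suc.prems(9) xs by simp
  \<comment> \<open>The cases are the letters \<open>Bottom\<close>, \<open>Top\<close> and
    \<open>NEnd\<close>: \<open>m\<close> has to wait, is output as a descent top, or is output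
    without starting a descent.\<close>
  consider "x \<noteq> m" | "x = m" "ys \<noteq> []" "hd ys < m" | "x = m" "ys = [] \<or> m \<le> hd ys"
    by fastforce
  then show ?case
  proof cases
    case 1
    then have "m < x" using \<open>m \<le> x\<close> by simp
    \<comment> \<open>All entries up to \<open>m\<close> come after \<open>x > m\<close>, so
      avoidance makes \<open>L\<close> decreasing. Its maximum \<open>m\<close> is therefore its
      head, and the rest is \<open>st\<close>.\<close>
    define L where "L = filter (\<lambda>y. y < Suc m) xs"
    have "L = filter (\<lambda>y. y < Suc m) (filter (\<lambda>y. y < x) ys)"
      using \<open>m < x\<close> unfolding L_def xs by (auto intro!: filter_cong)
    moreover have "sorted_wrt (>) (filter (\<lambda>y. y < x) ys)"
      using Suc.prems(1,2) xs by (simp add: avoids_312_Cons)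
    ultimately have sorted: "sorted_wrt (>) L"
      by (simp only: sorted_wrt_filter)
    have "m \<in> set L" "\<forall>y\<in>set L. y \<le> m"
      using Suc.prems(5) \<open>m < M\<close> by (auto simp: L_def)
    moreover from this obtain y L' where "L = y # L'"
      by (cases L) auto
    ultimately have L: "L = m # L'"
      using sorted by force
    have "filter (\<lambda>y. y < m) L = st"
      unfolding L_def filter_less_filter_less_Suc by (rule Suc.prems(6))
    moreover have "filter (\<lambda>y. y < m) L' = L'"
      using sorted L by (auto simp: filter_id_conv)
    ultimately have L_eq: "L = m # st"
      using L by simp
    have "\<exists>w. empties (length (m # st)) w \<and> length w = M - Suc m \<and> stack_output (m # st) (Suc m) w = xs"
    proof (rule Suc.hyps(1)[of "Suc m" "xs" "m # st"])
      show "set xs = set (m # st) \<union> {Suc m..<M}"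
        using Suc.prems(5) by (simp add: range)
      show "filter (\<lambda>x. x < Suc m) xs = m # st"
        using L_eq L_def by simp
      show "sorted_wrt (>) (m # st)"
        using sorted L_eq by simp
      show "\<forall>x\<in>set (m # st). x < Suc m" "xs \<noteq> [] \<Longrightarrow> Suc m \<le> hd xs" "d = M - Suc m" "Suc m \<le> M"
        using Suc.prems(8) Suc.hyps(2) \<open>m < M\<close> \<open>m < x\<close> xs by auto
    qed (fact Suc.prems)+
    then obtain w where "empties (length (m # st)) w" "length w = M - Suc m"
      "stack_output (m # st) (Suc m) w = xs" by blast
    then show ?thesis
      using \<open>m < M\<close> by (intro exI[of _ "Bottom # w"]) auto
  next
    case 2
    then obtain y zs where ys: "ys = y # zs"
      by (cases ys) auto
    then have "y < m" using 2 by simp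
    define st' where "st' = filter (\<lambda>x. x < m) zs"
    have st: "st = y # st'"
      using Suc.prems(6) \<open>y < m\<close> by (simp add: xs ys 2 st'_def)
    \<comment> \<open>As a descent bottom, \<open>y\<close> is no descent top, so the next entry
      \<open>z\<close> is not below \<open>y\<close>. Since \<open>st\<close> is decreasing,
      \<open>z\<close> cannot be below \<open>m\<close> either, and distinctness excludes
      \<open>z = m\<close>.\<close>
    have hd_zs: "Suc m \<le> hd zs" if nonempty: "zs \<noteq> []"
    proof -
      obtain z zs' where zs: "zs = z # zs'"
        using nonempty by (cases zs) auto
      have "y \<le> z"
        using Suc.prems(3) \<open>y < m\<close> unfolding xs ys zs 2 by (cases "y \<le> z") auto
      then have "\<not> z < m"
        using Suc.prems(7) unfolding st st'_def zs by auto
      then show ?thesis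
        using Suc.prems(1) unfolding xs ys zs 2 by auto
    qed
    have "\<exists>w. empties (length st') w \<and> length w = M - Suc m \<and> stack_output st' (Suc m) w = zs"
    proof (rule Suc.hyps(1)[of "Suc m" "zs" "st'"])
      show "set zs = set st' \<union> {Suc m..<M}"
      proof -
        have set_zs: "set zs = set xs - {m, y}"
          using Suc.prems(1) by (auto simp: xs ys 2)
        have "y \<notin> set st'" "m \<notin> set st'"
          using Suc.prems(1) by (auto simp: xs ys st'_def)
        then show ?thesis
          unfolding set_zs Suc.prems(5) st range using \<open>y < m\<close> by auto
      qed
      show "filter (\<lambda>x. x < Suc m) zs = st'"
        using Suc.prems(1) by (simp add: st'_def xs ys 2 filter_less_Suc)
      show "avoids_312 zs"
        using Suc.prems(1,2) by (auto simp: xs ys avoids_312_Cons)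
      show "fst ` descent_pairs zs \<inter> snd ` descent_pairs zs = {}"
        using Suc.prems(3) unfolding xs ys descent_pairs_Cons by blast
      show "distinct zs" "sorted_wrt (>) st'" "\<forall>x\<in>set st'. x < Suc m"
        using Suc.prems(1,7,8) unfolding xs ys st by auto
      show "d = M - Suc m" "Suc m \<le> M"
        using Suc.hyps(2) \<open>m < M\<close> by auto
    qed (fact hd_zs)
    then obtain w where "empties (length st') w" "length w = M - Suc m"
      "stack_output st' (Suc m) w = zs" by blast
    then show ?thesis
      using \<open>m < M\<close> 2 xs ys st by (intro exI[of _ "Top # w"]) auto
  next
    case 3
    have "\<exists>w. empties (length st) w \<and> length w = M - Suc m \<and> stack_output st (Suc m) w = ys"
    proof (rule Suc.hyps(1)[of "Suc m" "ys" "st"])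
      have set_ys: "set ys = set xs - {m}"
        using Suc.prems(1) by (auto simp: xs 3)
      have "m \<notin> set st"
        using Suc.prems(8) by blast
      then show "set ys = set st \<union> {Suc m..<M}"
        unfolding set_ys Suc.prems(5) range by auto
      show "filter (\<lambda>x. x < Suc m) ys = st"
        using Suc.prems(1,6) by (simp add: xs 3 filter_less_Suc)
      show "avoids_312 ys"
        using Suc.prems(1,2) by (auto simp: xs avoids_312_Cons)
      show "fst ` descent_pairs ys \<inter> snd ` descent_pairs ys = {}"
        using Suc.prems(3) unfolding xs descent_pairs_Cons by blast
      show "Suc m \<le> hd ys" if "ys \<noteq> []"
        using that 3 Suc.prems(1) xs by (cases ys) auto
      show "distinct ys" "\<forall>x\<in>set st. x < Suc m" "d = M - Suc m" "Suc m \<le> M"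
        using Suc.prems(1,8) Suc.hyps(2) \<open>m < M\<close> xs by auto
    qed (fact Suc.prems)
    then obtain w where "empties (length st) w" "length w = M - Suc m"
      "stack_output st (Suc m) w = ys" by blast
    then show ?thesis
      using \<open>m < M\<close> 3 xs by (intro exI[of _ "NEnd # w"]) auto
  qed
qed

subsection \<open>Values recording the roles\<close>

lemma finite_values_with: "finite (values_with c m w)"
  by (rule finite_subset[of _ "{m..<m + length w}"]) (auto simp: values_with_def)

lemma card_values_with:
  "card {v\<in>values_with c m w. v < m + n} = count_list (take n w) c"
proof (induction w arbitrary: m n)
  case Nil
  then show ?case by (simp add: values_with_Nil)
next
  case (Cons x w)
  show ?case
  proof (cases n)
    case 0
    then have "{v\<in>values_with c m (x # w). v < m + n} = {}"
      by (auto simp: values_with_def)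
    then show ?thesis
      by (simp only: 0) simp
  next
    case (Suc n')
    let ?V = "{v\<in>values_with c (Suc m) w. v < Suc m + n'}"
    have "{v\<in>values_with c m (x # w). v < m + n} = (if x = c then insert m ?V else ?V)"
      by (auto simp: values_with_Cons Suc)
    moreover have "m \<notin> ?V" "finite ?V"
      by (auto simp: values_with_def)
    ultimately show ?thesis
      using Cons.IH[of "Suc m" n'] by (simp add: Suc)
  qed
qed

lemma card_values_with_all: "card (values_with c m w) = count_list w c"
proof -
  have "{v\<in>values_with c m w. v < m + length w} = values_with c m w"
    by (auto simp: values_with_def)
  then show ?thesis
    using card_values_with[of c m w "length w"] by simp
qed

text \<open>Values are numbered from 1, so those up to \<open>n\<close> belong to the first
  \<open>n\<close> letters, and the condition on values becomes one on prefixes.\<close>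

lemma ballot_pair_values_with:
  "ballot_pair (values_with Top 1 w) (values_with NEnd 1 w) \<longleftrightarrow>
     count_list w Top = count_list w NEnd \<and>
     (\<forall>n. count_list (take n w) NEnd \<le> count_list (take n w) Top)"
proof -
  have *: "card {v\<in>values_with c 1 w. v \<le> n} = count_list (take n w) c" for c n
    using card_values_with[of c 1 w n] by (simp add: less_Suc_eq_le)
  show ?thesis
  proof
    assume "ballot_pair (values_with Top 1 w) (values_with NEnd 1 w)"
    then show "count_list w Top = count_list w NEnd \<and>
        (\<forall>n. count_list (take n w) NEnd \<le> count_list (take n w) Top)"
      using ballot_pairD[of "values_with Top 1 w" "values_with NEnd 1 w"]
      by (simp add: finite_values_with ballot_pair_def card_values_with_all flip: *)
  next
    assume "count_list w Top = count_list w NEnd \<and>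
        (\<forall>n. count_list (take n w) NEnd \<le> count_list (take n w) Top)"
    then show "ballot_pair (values_with Top 1 w) (values_with NEnd 1 w)"
      unfolding ballot_pair_def card_values_with_all * by simp
  qed
qed

lemma empties_0_if_ballot_words: "w \<in> ballot_words k k k \<Longrightarrow> empties 0 w"
  by (simp add: empties_iff ballot_words_def ballot_def balanced_def)

lemma length_ballot_words: "w \<in> ballot_words k k k \<Longrightarrow> length w = 3 * k"
  by (simp add: ballot_words_def length_eq_sum_count_letters)

section \<open>Passage between positions and values\<close>

lemma descent_pairs_nth:
  "descent_pairs xs = (\<lambda>i. (xs ! i, xs ! Suc i)) ` {i. Suc i < length xs \<and> xs ! Suc i < xs ! i}"
proof (induction xs)
  case (Cons x ys)
  have "{i. Suc i < length (x # ys) \<and> (x # ys) ! Suc i < (x # ys) ! i} =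
      (if ys \<noteq> [] \<and> hd ys < x then {0} else {}) \<union>
      Suc ` {i. Suc i < length ys \<and> ys ! Suc i < ys ! i}" (is "?L = ?R")
  proof (rule set_eqI)
    fix i
    show "i \<in> ?L \<longleftrightarrow> i \<in> ?R"
      by (cases i) (auto simp: hd_conv_nth)
  qed
  then show ?case
    by (simp only: descent_pairs_Cons Cons.IH) (auto simp: hd_conv_nth image_image)
qed simp

lemma descents_eq: "descents \<pi> = Suc ` {i. Suc i < length \<pi> \<and> \<pi> ! Suc i < \<pi> ! i}" (is "_ = ?R")
proof (rule set_eqI)
  fix i
  show "i \<in> descents \<pi> \<longleftrightarrow> i \<in> ?R"
    by (cases i) (auto simp: descents_def entry_def)
qed

lemma descent_pairs_entry:
  "fst ` descent_pairs \<pi> = entry \<pi> ` descents \<pi>"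
  "snd ` descent_pairs \<pi> = entry \<pi> ` Suc ` descents \<pi>"
  by (simp_all add: descent_pairs_nth descents_eq image_image entry_def)

text \<open>In a reduced configuration with \<open>k\<close> hooks on \<open>3 * k\<close> points
  these are exactly the positions of the northeast endpoints.\<close>

definition free_positions :: "nat list \<Rightarrow> nat set" where
  "free_positions \<pi> = {1..length \<pi>} - descents \<pi> - Suc ` descents \<pi>"

lemma descents_subset: "descents \<pi> \<subseteq> {1..length \<pi>}" "Suc ` descents \<pi> \<subseteq> {1..length \<pi>}"
  by (auto simp: descents_def)

lemma Av_312_entry:
  assumes "\<pi> \<in> Av_312 n"
  shows "length \<pi> = n" "distinct \<pi>" "avoids_312 \<pi>" "inj_on (entry \<pi>) {1..n}"
    "entry \<pi> ` {1..n} = {1..n}"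
proof -
  show len: "length \<pi> = n" and dist: "distinct \<pi>" and "avoids_312 \<pi>"
    using assms length_finite_permutations_of_set[of \<pi> "{1..n}"]
    by (auto simp: Av_312_def permutations_of_set_def)
  show "inj_on (entry \<pi>) {1..n}"
    using dist len by (auto simp: inj_on_def entry_def nth_eq_iff_index_eq)
  have "{1..n} = Suc ` {..<n}"
    by (simp add: lessThan_atLeast0 image_Suc_atLeastLessThan atLeastLessThanSuc_atLeastAtMost)
  then have "entry \<pi> ` {1..n} = (!) \<pi> ` {..<n}"
    by (simp add: entry_def image_image)
  also have "\<dots> = set \<pi>"
    using len by (auto simp: set_conv_nth)
  also have "\<dots> = {1..n}"
    using assms by (simp add: Av_312_def permutations_of_set_def)
  finally show "entry \<pi> ` {1..n} = {1..n}" .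
qed

text \<open>Otherwise \<open>entry \<pi> i\<close> exceeds \<open>entry \<pi> j\<close>. As
  \<open>j\<close> is no descent bottom, the entry at \<open>j - 1\<close> is below the one at
  \<open>j\<close>, so \<open>i\<close>, \<open>j - 1\<close>, \<open>j\<close> form a 312
  pattern.\<close>

lemma entry_less_if_not_descent_bottom:
  assumes "\<pi> \<in> Av_312 n" "1 \<le> i" "i < j" "j \<le> n" "j \<notin> Suc ` descents \<pi>"
  shows "entry \<pi> i < entry \<pi> j"
proof (rule ccontr)
  note \<pi> = Av_312_entry[OF assms(1)]
  have neq: "entry \<pi> x \<noteq> entry \<pi> j" if "1 \<le> x" "x < j" for x
    using inj_onD[OF \<pi>(4), of x j] that assms by auto
  assume "\<not> entry \<pi> i < entry \<pi> j"
  then have gt: "entry \<pi> j < entry \<pi> i"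
    using neq[of i] assms by simp
  have "j - 1 \<notin> descents \<pi>"
    using assms by (metis Suc_diff_1 image_eqI less_imp_le_nat order_less_le_trans zero_less_one)
  then have "entry \<pi> (j - 1) \<le> entry \<pi> j"
    using assms \<pi>(1) by (auto simp: descents_def)
  then have "i \<noteq> j - 1" "entry \<pi> (j - 1) < entry \<pi> j"
    using gt neq[of "j - 1"] assms by auto
  then have "1 \<le> i \<and> i < j - 1 \<and> j - 1 < j \<and> j \<le> length \<pi> \<and>
      entry \<pi> (j - 1) < entry \<pi> j \<and> entry \<pi> j < entry \<pi> i"
    using gt assms \<pi>(1) by auto
  then show False
    using \<pi>(3) unfolding avoids_312_def by blast
qed

subsection \<open>Reduced configurations as noncrossing matchings\<close>

lemma point_eq_iff: "point \<pi> i = point \<pi> j \<longleftrightarrow> i = j"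
  by (auto simp: point_def)

lemma inj_point: "inj (point \<pi>)"
  by (simp add: inj_def point_eq_iff)

lemma point_image_eq_iff: "point \<pi> ` A = point \<pi> ` B \<longleftrightarrow> A = B"
  by (rule inj_image_eq_iff[OF inj_point])

lemma point_image_subset_iff: "point \<pi> ` A \<subseteq> point \<pi> ` B \<longleftrightarrow> A \<subseteq> B"
  by (rule inj_image_subset_iff[OF inj_point])

lemma SW_image: "SW \<pi> ` H = point \<pi> ` fst ` H"
  by (simp add: SW_def image_image)

lemma NE_image: "NE \<pi> ` H = point \<pi> ` snd ` H"
  by (simp add: NE_def image_image)

lemma descent_bottoms_image: "descent_bottoms \<pi> = point \<pi> ` Suc ` descents \<pi>"
  by (simp add: descent_bottoms_def image_image)

lemma mem_hook_curve:
  "(x, y) \<in> hook_curve \<pi> (i, j) \<longleftrightarrow>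
     x = real i \<and> real (entry \<pi> i) \<le> y \<and> y \<le> real (entry \<pi> j) \<or>
     real i \<le> x \<and> x \<le> real j \<and> y = real (entry \<pi> j)"
  by auto

lemma reduced_iff:
  "reduced \<pi> H \<longleftrightarrow> {1..length \<pi>} \<subseteq> fst ` H \<union> snd ` H \<union> Suc ` descents \<pi>"
  unfolding reduced_def plot_def SW_image NE_image descent_bottoms_image
  by (simp only: point_image_subset_iff flip: image_Un)

lemma hooksD:
  assumes "H \<subseteq> hooks \<pi>" "(i, j) \<in> H"
  shows "1 \<le> i" "i < j" "j \<le> length \<pi>" "entry \<pi> i < entry \<pi> j"
  using assms by (auto simp: hooks_def)

text \<open>Injectivity and noncrossing each follow by exhibiting a common point of two curves that
  is not an endpoint of the first.\<close>

lemma valid_hook_configurationD: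
  assumes "valid_hook_configuration \<pi> H"
  shows "H \<subseteq> hooks \<pi>" "fst ` H = descents \<pi>" "inj_on fst H" "inj_on snd H"
    "\<And>i j i' j'. (i, j) \<in> H \<Longrightarrow> (i', j') \<in> H \<Longrightarrow> \<not> (i < i' \<and> i' < j \<and> j < j')"
proof -
  show sub: "H \<subseteq> hooks \<pi>"
    using assms by (simp add: valid_hook_configuration_def)
  note hookD = hooksD[OF sub]
  show "fst ` H = descents \<pi>"
    using assms
    by (simp add: valid_hook_configuration_def SW_image descent_tops_def point_image_eq_iff)
  have no_point_above: "\<forall>(i, j)\<in>H. \<not> (\<exists>l. i < l \<and> l < j \<and> entry \<pi> j < entry \<pi> l)"
    and curves: "\<forall>h\<in>H. \<forall>h'\<in>H. h \<noteq> h' \<longrightarrow>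
      hook_curve \<pi> h \<inter> hook_curve \<pi> h' \<subseteq> {SW \<pi> h, NE \<pi> h} \<inter> {SW \<pi> h', NE \<pi> h'}"
    using assms unfolding valid_hook_configuration_def by simp_all
  have above: "entry \<pi> l \<le> entry \<pi> j" if "(i, j) \<in> H" "i < l" "l < j" for i j l
    using bspec[OF no_point_above that(1)] that(2,3) by force
  have meet: "p = point \<pi> i \<or> p = point \<pi> j"
    if "(i, j) \<in> H" "(i', j') \<in> H" "(i, j) \<noteq> (i', j')"
      "p \<in> hook_curve \<pi> (i, j)" "p \<in> hook_curve \<pi> (i', j')" for i j i' j' p
  proof -
    have "hook_curve \<pi> (i, j) \<inter> hook_curve \<pi> (i', j') \<subseteq> {SW \<pi> (i, j), NE \<pi> (i, j)}"
      using curves[rule_format, OF that(1-3)] by blast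
    then show ?thesis
      using that(4,5) by (auto simp: SW_def NE_def)
  qed
  have fst_inj: "j \<le> j'" if H: "(i, j) \<in> H" "(i, j') \<in> H" for i j j'
  proof (rule ccontr)
    assume "\<not> j \<le> j'"
    \<comment> \<open>The lower of the two corners above \<open>i\<close> lies on both vertical
      segments.\<close>
    let ?p = "(real i, real (min (entry \<pi> j) (entry \<pi> j')))"
    have "?p \<in> hook_curve \<pi> (i, j)" "?p \<in> hook_curve \<pi> (i, j')"
      using hookD(4)[OF H(1)] hookD(4)[OF H(2)] by (auto simp: mem_hook_curve)
    then have "?p = point \<pi> i \<or> ?p = point \<pi> j"
      using meet[OF H] \<open>\<not> j \<le> j'\<close> by blast
    then show False
      using hookD(2,4)[OF H(1)] hookD(4)[OF H(2)] by (auto simp: point_def)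
  qed
  have "j = j'" if "(i, j) \<in> H" "(i, j') \<in> H" for i j j'
    using fst_inj that by (meson antisym)
  then show "inj_on fst H"
    by (auto simp: inj_on_def)
  have snd_inj: "i' \<le> i" if H: "(i, j) \<in> H" "(i', j) \<in> H" for i i' j
  proof (rule ccontr)
    assume "\<not> i' \<le> i"
    \<comment> \<open>Both hooks contain the horizontal segment from column \<open>i'\<close> to
      column \<open>j\<close>; its left end lies strictly between columns \<open>i\<close> and
      \<open>j\<close>.\<close>
    let ?p = "(real i', real (entry \<pi> j))"
    have "?p \<in> hook_curve \<pi> (i, j)" "?p \<in> hook_curve \<pi> (i', j)"
      using hookD(2,4)[OF H(1)] hookD(2,4)[OF H(2)] \<open>\<not> i' \<le> i\<close> by (auto simp: mem_hook_curve)
    then have "?p = point \<pi> i \<or> ?p = point \<pi> j"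
      using meet[OF H] \<open>\<not> i' \<le> i\<close> by blast
    then show False
      using hookD(2)[OF H(2)] \<open>\<not> i' \<le> i\<close> by (auto simp: point_def)
  qed
  have "i = i'" if "(i, j) \<in> H" "(i', j) \<in> H" for i i' j
    using snd_inj that by (meson antisym)
  then show "inj_on snd H"
    by (auto simp: inj_on_def)
  show "\<not> (i < i' \<and> i' < j \<and> j < j')" if H: "(i, j) \<in> H" "(i', j') \<in> H" for i j i' j'
  proof
    assume *: "i < i' \<and> i' < j \<and> j < j'"
    \<comment> \<open>Here the horizontal segment of \<open>(i, j)\<close> meets the vertical
      segment of \<open>(i', j')\<close>. The heights fit because no point lies above either
      hook.\<close>
    let ?p = "(real i', real (entry \<pi> j))"
    have "entry \<pi> i' \<le> entry \<pi> j" "entry \<pi> j \<le> entry \<pi> j'"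
      using above[OF H(1)] above[OF H(2)] * by auto
    then have "?p \<in> hook_curve \<pi> (i, j)" "?p \<in> hook_curve \<pi> (i', j')"
      using * by (auto simp: mem_hook_curve)
    then have "?p = point \<pi> i \<or> ?p = point \<pi> j"
      using meet[OF H] * by blast
    then show False
      using * by (auto simp: point_def)
  qed
qed

text \<open>Three sets of at most \<open>k\<close> elements can cover \<open>3 * k\<close> elements
  only if none is counted twice.\<close>

lemma card_cover_disjoint:
  assumes "finite A" "finite B" "finite C" "X \<subseteq> A \<union> B \<union> C"
    and "card A \<le> k" "card B \<le> k" "card C \<le> k" "card X = 3 * k"
  shows "A \<inter> B = {}" "A \<inter> C = {}" "B \<inter> C = {}"
proof -
  have "3 * k \<le> card (A \<union> B \<union> C)"
    using assms by (metis card_mono finite_Un)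
  moreover have "card (A \<union> B \<union> C) + card ((A \<union> B) \<inter> C) = card (A \<union> B) + card C"
    "card (A \<union> B) + card (A \<inter> B) = card A + card B"
    using card_Un_Int[of "A \<union> B" C] card_Un_Int[of A B] assms(1-3) by simp_all
  ultimately have "card ((A \<union> B) \<inter> C) = 0" "card (A \<inter> B) = 0"
    using assms(5-7) by linarith+
  then show "A \<inter> B = {}" "A \<inter> C = {}" "B \<inter> C = {}"
    using assms(1-3) by auto
qed

lemma RedVHC_imp_noncrossing_matching:
  assumes "(\<pi>, H) \<in> RedVHC k (Av_312 (3 * k))"
  shows "\<pi> \<in> Av_312 (3 * k)" "card (descents \<pi>) = k" "descents \<pi> \<inter> Suc ` descents \<pi> = {}"
    "noncrossing_matching (descents \<pi>) (free_positions \<pi>) H"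
proof -
  show Av: "\<pi> \<in> Av_312 (3 * k)"
    using assms by (simp add: RedVHC_def)
  have valid: "valid_hook_configuration \<pi> H" and red: "reduced \<pi> H" and card: "card H = k"
    using assms by (auto simp: RedVHC_def)
  note len = Av_312_entry(1)[OF Av]
  note vD = valid_hook_configurationD[OF valid]
  have fin: "finite (descents \<pi>)"
    using descents_subset(1) finite_subset by blast
  then have "finite H"
    using vD(2,3) finite_imageD by metis
  show card_D: "card (descents \<pi>) = k"
    using vD(2,3) card card_image by metis
  have "card (snd ` H) \<le> k" "card (Suc ` descents \<pi>) \<le> k"
    using card card_D \<open>finite H\<close> fin card_image_le by metis+
  then have disj: "descents \<pi> \<inter> snd ` H = {}" "descents \<pi> \<inter> Suc ` descents \<pi> = {}"
    "snd ` H \<inter> Suc ` descents \<pi> = {}"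
    using card_cover_disjoint[of "descents \<pi>" "snd ` H" "Suc ` descents \<pi>" "{1..length \<pi>}" k]
      red fin \<open>finite H\<close> card_D len by (simp_all add: reduced_iff vD(2))
  show "descents \<pi> \<inter> Suc ` descents \<pi> = {}"
    by fact
  have "snd ` H \<subseteq> {1..length \<pi>}"
    using hooksD[OF vD(1)] by force
  then have "snd ` H = free_positions \<pi>"
    using red disj unfolding reduced_iff vD(2) free_positions_def by blast
  then show "noncrossing_matching (descents \<pi>) (free_positions \<pi>) H"
    unfolding noncrossing_matching_def using vD(2-4) hooksD(2)[OF vD(1)] vD(5)
    by (simp add: split_def) (metis prod.collapse)
qed

text \<open>Free positions are left-to-right maxima, so heights of northeast endpoints increase with
  position. Noncrossing then makes the curves of distinct hooks disjoint altogether.\<close>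

lemma noncrossing_matching_imp_RedVHC:
  assumes Av: "\<pi> \<in> Av_312 (3 * k)" and card: "card (descents \<pi>) = k"
    and disj: "descents \<pi> \<inter> Suc ` descents \<pi> = {}"
    and M: "noncrossing_matching (descents \<pi>) (free_positions \<pi>) H"
  shows "(\<pi>, H) \<in> RedVHC k (Av_312 (3 * k))"
proof -
  note len = Av_312_entry(1)[OF Av]
  have fst: "fst ` H = descents \<pi>" "inj_on fst H"
    and snd: "snd ` H = free_positions \<pi>" "inj_on snd H"
    and less: "\<And>i j. (i, j) \<in> H \<Longrightarrow> i < j"
    and nc: "\<And>i j i' j'. (i, j) \<in> H \<Longrightarrow> (i', j') \<in> H \<Longrightarrow> \<not> (i < i' \<and> i' < j \<and> j < j')"
    using M unfolding noncrossing_matching_def by (blast, blast, blast, blast, blast, fast)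
  have mem: "i \<in> descents \<pi>" "j \<in> free_positions \<pi>" if "(i, j) \<in> H" for i j
    using fst snd that by force+
  have lrmax: "entry \<pi> l < entry \<pi> j" if "(i, j) \<in> H" "1 \<le> l" "l < j" for i j l
    using entry_less_if_not_descent_bottom[OF Av] mem[OF that(1)] that(2,3) len
    by (auto simp: free_positions_def)
  have pos: "1 \<le> i" if "(i, j) \<in> H" for i j
    using mem(1)[OF that] by (simp add: descents_def)
  have hooks: "H \<subseteq> hooks \<pi>"
    using less mem pos lrmax by (fastforce simp: hooks_def free_positions_def)
  have disjoint_curves: "hook_curve \<pi> (i, j) \<inter> hook_curve \<pi> (i', j') = {}"
    if H: "(i, j) \<in> H" "(i', j') \<in> H" and "i < i'" for i j i' j'
  proof -
    have "j \<noteq> i'"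
      using mem(1)[OF H(2)] mem(2)[OF H(1)] by (auto simp: free_positions_def)
    moreover have "j \<noteq> j'"
      using inj_onD[OF snd(2), OF _ H] \<open>i < i'\<close> by auto
    \<comment> \<open>The hooks are side by side or nested. When nested, the inner one stays
      strictly below the horizontal segment of the outer one and to the right of its vertical
      segment.\<close>
    ultimately consider "j < i'" | "i' < j" "j' < j"
      using nc[OF H] \<open>i < i'\<close> by linarith
    then show ?thesis
    proof cases
      case 1
      then show ?thesis
        using less[OF H(1)] less[OF H(2)] by (auto simp: mem_hook_curve)
    next
      case 2
      then have "entry \<pi> j' < entry \<pi> j"
        using lrmax[OF H(1), of j'] pos[OF H(2)] less[OF H(2)] by simp
      moreover have "entry \<pi> i' < entry \<pi> j'"
        using lrmax[OF H(2) pos[OF H(2)] less[OF H(2)]] .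
      ultimately show ?thesis
        using \<open>i < i'\<close> by (auto simp: mem_hook_curve)
    qed
  qed
  have "valid_hook_configuration \<pi> H"
    unfolding valid_hook_configuration_def
  proof (intro conjI)
    show "SW \<pi> ` H = descent_tops \<pi>"
      by (simp add: SW_image fst descent_tops_def)
    show "\<forall>(i, j)\<in>H. \<not> (\<exists>l. i < l \<and> l < j \<and> entry \<pi> j < entry \<pi> l)"
    proof (clarify)
      fix i j l assume "(i, j) \<in> H" "i < l" "l < j" "entry \<pi> j < entry \<pi> l"
      then show False
        using lrmax[of i j l] pos[of i j] by simp
    qed
    show "\<forall>h\<in>H. \<forall>h'\<in>H. h \<noteq> h' \<longrightarrow>
        hook_curve \<pi> h \<inter> hook_curve \<pi> h' \<subseteq> {SW \<pi> h, NE \<pi> h} \<inter> {SW \<pi> h', NE \<pi> h'}"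
    proof (intro ballI impI)
      fix h h' assume h: "h \<in> H" "h' \<in> H" "h \<noteq> h'"
      then have "fst h \<noteq> fst h'"
        using inj_onD[OF fst(2)] by blast
      then consider "fst h < fst h'" | "fst h' < fst h"
        by linarith
      then have "hook_curve \<pi> h \<inter> hook_curve \<pi> h' = {}"
      proof cases
        case 1
        then show ?thesis
          using disjoint_curves[of "fst h" "snd h" "fst h'" "snd h'"] h by simp
      next
        case 2
        then show ?thesis
          using disjoint_curves[of "fst h'" "snd h'" "fst h" "snd h"] h by (simp add: Int_commute)
      qed
      then show "hook_curve \<pi> h \<inter> hook_curve \<pi> h' \<subseteq> {SW \<pi> h, NE \<pi> h} \<inter> {SW \<pi> h', NE \<pi> h'}"
        by simp
    qed
  qed (fact hooks)
  moreover have "reduced \<pi> H"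
    unfolding reduced_iff fst snd free_positions_def by blast
  moreover have "card H = k"
    using card fst card_image by metis
  ultimately show ?thesis
    using Av by (simp add: RedVHC_def)
qed

section \<open>Bijections linking configurations, permutations and ballot words\<close>

definition reduced_perms :: "nat \<Rightarrow> nat list set" where
  "reduced_perms k = {\<pi> \<in> Av_312 (3 * k). card (descents \<pi>) = k \<and>
     descents \<pi> \<inter> Suc ` descents \<pi> = {} \<and> ballot_pair (descents \<pi>) (free_positions \<pi>)}"

text \<open>Uniqueness of noncrossing matchings gives injectivity, since the permutation determines
  the hooks; their existence gives surjectivity.\<close>

lemma bij_betw_RedVHC: "bij_betw fst (RedVHC k (Av_312 (3 * k))) (reduced_perms k)"
proof -
  have fin: "finite (descents \<pi>)" "finite (free_positions \<pi>)" for \<pi>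
    using finite_subset[OF descents_subset(1)] by (auto simp: free_positions_def)
  have disj: "descents \<pi> \<inter> free_positions \<pi> = {}" for \<pi>
    by (auto simp: free_positions_def)
  have inj: "inj_on fst (RedVHC k (Av_312 (3 * k)))"
  proof (rule inj_onI, clarsimp)
    fix \<pi> H H' assume "(\<pi>, H) \<in> RedVHC k (Av_312 (3 * k))" "(\<pi>, H') \<in> RedVHC k (Av_312 (3 * k))"
    note M = RedVHC_imp_noncrossing_matching(4)[OF this(1)]
      RedVHC_imp_noncrossing_matching(4)[OF this(2)]
    show "H = H'"
      using ex1_noncrossing_matching[OF noncrossing_matching_imp_ballot_pair[OF M(1) fin(1)] fin disj] M
      by blast
  qed
  have "fst ` RedVHC k (Av_312 (3 * k)) = reduced_perms k"
  proof (intro equalityI subsetI)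
    fix \<pi> assume "\<pi> \<in> fst ` RedVHC k (Av_312 (3 * k))"
    then obtain H where "(\<pi>, H) \<in> RedVHC k (Av_312 (3 * k))"
      by auto
    note * = RedVHC_imp_noncrossing_matching[OF this]
    then show "\<pi> \<in> reduced_perms k"
      using noncrossing_matching_imp_ballot_pair[OF *(4) fin(1)] by (simp add: reduced_perms_def)
  next
    fix \<pi> assume \<pi>: "\<pi> \<in> reduced_perms k"
    then obtain H where "noncrossing_matching (descents \<pi>) (free_positions \<pi>) H"
      using ex1_noncrossing_matching[of "descents \<pi>" "free_positions \<pi>"] fin disj
      by (auto simp: reduced_perms_def)
    then have "(\<pi>, H) \<in> RedVHC k (Av_312 (3 * k))"
      using \<pi> noncrossing_matching_imp_RedVHC unfolding reduced_perms_def by blast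
    then show "\<pi> \<in> fst ` RedVHC k (Av_312 (3 * k))"
      by force
  qed
  then show ?thesis
    using inj by (simp add: bij_betw_def)
qed

lemma stack_output_properties:
  assumes "empties 0 w" "length w = n"
  defines "\<pi> \<equiv> stack_output [] 1 w"
  shows "\<pi> \<in> Av_312 n" "entry \<pi> ` descents \<pi> = values_with Top 1 w"
    "entry \<pi> ` Suc ` descents \<pi> = values_with Bottom 1 w"
    "entry \<pi> ` free_positions \<pi> = values_with NEnd 1 w"
    "card (descents \<pi>) = count_list w Top" "descents \<pi> \<inter> Suc ` descents \<pi> = {}"
    "ballot_pair (descents \<pi>) (free_positions \<pi>) \<longleftrightarrow>
       ballot_pair (values_with Top 1 w) (values_with NEnd 1 w)"
proof -
  have "mset \<pi> = mset [1..<Suc n]"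
    using mset_stack_output[of "[]" w 1] assms by simp
  then have "set \<pi> = {1..n}" "distinct \<pi>"
    by (metis atLeastLessThanSuc_atLeastAtMost mset_eq_setD set_upt)
       (metis \<open>mset \<pi> = _\<close> distinct_upt mset_eq_imp_distinct_iff)
  then show Av: "\<pi> \<in> Av_312 n"
    using avoids_312_stack_output[of "[]" w 1] assms by (simp add: Av_312_def permutations_of_set_def)
  note entry = Av_312_entry[OF Av]
  show top: "entry \<pi> ` descents \<pi> = values_with Top 1 w"
    and bot: "entry \<pi> ` Suc ` descents \<pi> = values_with Bottom 1 w"
    using descent_pairs_stack_output[of "[]" w 1] assms by (simp_all flip: descent_pairs_entry)
  note sub = descents_subset[of \<pi>, unfolded entry(1)]
  have "entry \<pi> ` free_positions \<pi> = {1..n} - values_with Top 1 w - values_with Bottom 1 w"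
  proof -
    have "entry \<pi> ` free_positions \<pi> =
        entry \<pi> ` {1..n} - entry \<pi> ` descents \<pi> - entry \<pi> ` Suc ` descents \<pi>"
      unfolding free_positions_def entry(1)
      using inj_on_image_set_diff[OF entry(4), of "{1..n} - descents \<pi>" "Suc ` descents \<pi>"]
        inj_on_image_set_diff[OF entry(4), of "{1..n}" "descents \<pi>"] sub by blast
    then show ?thesis
      by (simp only: top bot entry(5))
  qed
  also have "\<dots> = values_with NEnd 1 w"
  proof (rule set_eqI)
    fix v
    show "v \<in> {1..n} - values_with Top 1 w - values_with Bottom 1 w \<longleftrightarrow> v \<in> values_with NEnd 1 w"
      using assms(2) by (cases "w ! (v - 1)") (auto simp: values_with_def)
  qed
  finally show free: "entry \<pi> ` free_positions \<pi> = values_with NEnd 1 w" .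
  have "card (descents \<pi>) = card (entry \<pi> ` descents \<pi>)"
    using entry(4) sub(1) by (metis card_image inj_on_subset)
  then show "card (descents \<pi>) = count_list w Top"
    by (simp add: top card_values_with_all)
  have "entry \<pi> ` descents \<pi> \<inter> entry \<pi> ` Suc ` descents \<pi> = {}"
    unfolding top bot by (auto simp: values_with_def)
  then show disj: "descents \<pi> \<inter> Suc ` descents \<pi> = {}"
    by blast
  \<comment> \<open>Tops and free positions are not bottoms, hence left-to-right maxima, so the
    ballot condition may be read by position or by value.\<close>
  have "strict_mono_on (descents \<pi> \<union> free_positions \<pi>) (entry \<pi>)"
  proof (rule strict_mono_onI)
    fix i j assume "i \<in> descents \<pi> \<union> free_positions \<pi>" "j \<in> descents \<pi> \<union> free_positions \<pi>" "i < j"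
    then show "entry \<pi> i < entry \<pi> j"
      using sub disj entry(1)
      by (intro entry_less_if_not_descent_bottom[OF Av]) (auto simp: free_positions_def)
  qed
  from ballot_pair_image[OF this]
  show "ballot_pair (descents \<pi>) (free_positions \<pi>) \<longleftrightarrow>
      ballot_pair (values_with Top 1 w) (values_with NEnd 1 w)"
    by (simp add: top free)
qed

text \<open>\<open>empties 0 w\<close> compares \<open>Top\<close> with \<open>Bottom\<close>, and
  the ballot pair compares \<open>NEnd\<close> with \<open>Top\<close>, both with equality on the
  whole word; the length then makes every count \<open>k\<close>.\<close>

lemma stack_output_in_reduced_perms_iff:
  assumes "empties 0 w" "length w = 3 * k"
  shows "stack_output [] 1 w \<in> reduced_perms k \<longleftrightarrow> w \<in> ballot_words k k k"
proof -
  note props = stack_output_properties[OF assms]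
  have "count_list w Top = count_list w Bottom"
    "\<forall>n. count_list (take n w) Top \<le> count_list (take n w) Bottom"
    using assms(1) by (simp_all add: empties_iff)
  then show ?thesis
    using props(1,5,6) length_eq_sum_count_letters[of w] assms(2)
    unfolding reduced_perms_def mem_Collect_eq props(7) ballot_pair_values_with
    by (auto simp: ballot_words_def ballot_def balanced_def)
qed

text \<open>The permutation fixes the role of each value and hence each letter, so the map is
  injective; surjectivity is \<open>stack_output_surj\<close> started with an empty stack.\<close>

lemma bij_betw_stack_output: "bij_betw (stack_output [] 1) (ballot_words k k k) (reduced_perms k)"
  unfolding bij_betw_def
proof
  show "inj_on (stack_output [] 1) (ballot_words k k k)"
  proof (rule inj_onI)
    fix w w' assume w: "w \<in> ballot_words k k k" "w' \<in> ballot_words k k k"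
      and eq: "stack_output [] 1 w = stack_output [] 1 w'"
    note props = stack_output_properties[OF empties_0_if_ballot_words length_ballot_words]
    have "values_with c 1 w = values_with c 1 w'" for c
      using props(2-4)[OF w(1) w(1)] props(2-4)[OF w(2) w(2)] eq by (cases c) simp_all
    moreover have "i < length v \<Longrightarrow> v ! i = c \<longleftrightarrow> Suc i \<in> values_with c 1 v" for i c v
      by (simp add: values_with_def)
    ultimately show "w = w'"
      using length_ballot_words[OF w(1)] length_ballot_words[OF w(2)]
      by (metis nth_equalityI)
  qed
next
  show "stack_output [] 1 ` ballot_words k k k = reduced_perms k"
  proof (intro equalityI subsetI)
    fix \<pi> assume "\<pi> \<in> stack_output [] 1 ` ballot_words k k k"
    then show "\<pi> \<in> reduced_perms k"
      using stack_output_in_reduced_perms_iff empties_0_if_ballot_words length_ballot_words by blast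
  next
    fix \<pi> assume \<pi>: "\<pi> \<in> reduced_perms k"
    then have Av: "\<pi> \<in> Av_312 (3 * k)" and disj: "descents \<pi> \<inter> Suc ` descents \<pi> = {}"
      by (auto simp: reduced_perms_def)
    note entry = Av_312_entry[OF Av]
    have set: "set \<pi> = {1..<Suc (3 * k)}"
      using Av by (simp add: Av_312_def permutations_of_set_def atLeastLessThanSuc_atLeastAtMost)
    \<comment> \<open>Injectivity of \<open>entry \<pi>\<close> carries the disjointness of tops and
      bottoms from positions to values, the form that \<open>stack_output_surj\<close>
      requires.\<close>
    have "entry \<pi> ` descents \<pi> \<inter> entry \<pi> ` Suc ` descents \<pi> = entry \<pi> ` (descents \<pi> \<inter> Suc ` descents \<pi>)"
      using inj_on_image_Int[OF entry(4), of "descents \<pi>" "Suc ` descents \<pi>"]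
        descents_subset[of \<pi>] entry(1) by simp
    then have "fst ` descent_pairs \<pi> \<inter> snd ` descent_pairs \<pi> = {}"
      by (simp add: descent_pairs_entry disj)
    note no_double_descent = this
    have "\<exists>w. empties (length ([] :: nat list)) w \<and> length w = Suc (3 * k) - 1 \<and> stack_output [] 1 w = \<pi>"
    proof (rule stack_output_surj[OF entry(2,3) no_double_descent])
      show "1 \<le> hd \<pi>" if "\<pi> \<noteq> []"
        using hd_in_set[OF that] set by simp
      show "filter (\<lambda>x. x < 1) \<pi> = []"
        using set by (auto simp: filter_empty_conv)
      show "set \<pi> = set [] \<union> {1..<Suc (3 * k)}"
        by (simp only: set list.set Un_empty_left)
    qed simp_all
    then obtain w where "empties 0 w" "length w = 3 * k" and w: "stack_output [] 1 w = \<pi>"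
      unfolding list.size(3) diff_Suc_1 by blast
    then have "w \<in> ballot_words k k k"
      using \<pi> stack_output_in_reduced_perms_iff[of w k] unfolding w by blast
    then show "\<pi> \<in> stack_output [] 1 ` ballot_words k k k"
      unfolding w[symmetric] by (rule imageI)
  qed
qed

theorem corollary3p2p1:
  fixes k :: nat
  assumes "k \<ge> 1"
  shows "real (card (RedVHC k (Av_312 (3 * k)))) =
    2 * (fact (3 * k) / (fact k * fact (k + 1) * fact (k + 2)))"
proof -
  have "card (RedVHC k (Av_312 (3 * k))) = card (reduced_perms k)"
    by (rule bij_betw_same_card[OF bij_betw_RedVHC])
  also have "\<dots> = card (ballot_words k k k)"
    by (rule bij_betw_same_card[OF bij_betw_stack_output, symmetric])
  finally show ?thesis
    by (simp only: card_ballot_words_diag)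
qed

end
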